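(* $[\mathbf{Txt}\mathbf{It}\mathbf{Bc}_C]_{\mathbf{REC}} = [\mathbf{Txt}\mathbf{G}\mathbf{Bc}_C]_{\mathbf{REC}}$.
   Context: Fix an acceptable numbering $(\varphi_e)_{e\in\mathbb{N}}$ of all partial computable functions. A number $e$ is a $C$-index if $\varphi_e$ is total with values in $\{0,1\}$; then $C_e=\{x:\varphi_e(x)=1\}$. $\mathbf{REC}$ is the collection of recursive subsets of $\mathbb{N}$; $\mathcal{P}$ denotes the partial computable functions. Fix a pause symbol $\#$. A text is a total function $T:\mathbb{N}\to\mathbb{N}\cup\{\#\}$, $\mathrm{content}(T)=\mathrm{range}(T)\setminus\{\#\}$, $T$ is a text for $L$ if $\mathrm{content}(T)=L$, $T[n]=(T(0),\dots,T(n-1))$. A learner is some $h\in\mathcal{P}$. Hypothesis sequences: $\mathbf{G}(h,T)(i)=h(T[i])$; iterative $\mathbf{It}(h,T)(0)=h(\varepsilon)$ and $\mathbf{It}(h,T)(i)=h(\mathbf{It}(h,T)(i-1),T(i-1))$ for $i>0$. Restriction $\mathbf{Bc}_C$ on hypothesis sequence $p$ and text $T$: there is $n_0$ such that for all $n\ge n_0$, $p(n)$ is a $C$-index with $C_{p(n)}=\mathrm{content}(T)$. A learner $h$ $\mathbf{Txt}\beta\mathbf{Bc}_C$-learns $L$ iff $\mathbf{Bc}_C(\beta(h,T),T)$ holds for every text $T$ for $L$; $[\mathbf{Txt}\beta\mathbf{Bc}_C]_{\mathbf{REC}}$ is the set of all classes $\mathcal{L}\subseteq\mathbf{REC}$ for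 which some $h\in\mathcal{P}$ learns every $L\in\mathcal{L}$. *)

theory Defs
  imports Complex_Main "HOL-Library.Nat_Bijection"
begin

text \<open>
  Kleene's mu-recursive functions, as terms with a partial evaluation on argument lists
  (\<^const>\<open>None\<close> means undefined). Terms carry no arity: once the length of the argument list
  is fixed, the number of arguments of every subterm is determined.
\<close>

datatype recf =
    Zero
  | Succ
  | Proj nat
  | Comp recf "recf list"
  | PrimRec recf recf
  | Mu recf

primrec run :: "recf \<Rightarrow> nat list \<Rightarrow> nat option" where
  "run Zero = (\<lambda>xs. Some 0)"
| "run Succ = (\<lambda>xs. case xs of [] \<Rightarrow> None | x # _ \<Rightarrow> Some (Suc x))"
| "run (Proj i) = (\<lambda>xs. if i < length xs then Some (xs ! i) else None)"
| "run (Comp f gs) =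
    (\<lambda>xs. Option.bind (those (map (\<lambda>r. r xs) (map run gs))) (run f))"
| "run (PrimRec f g) =
    (\<lambda>xs. case xs of
        [] \<Rightarrow> None
      | n # ys \<Rightarrow>
          rec_nat (run f ys) (\<lambda>m r. Option.bind r (\<lambda>v. run g (m # v # ys))) n)"
| "run (Mu f) =
    (\<lambda>xs. if \<exists>y. run f (y # xs) = Some 0 \<and> (\<forall>i<y. run f (i # xs) \<noteq> None)
          then Some (LEAST y. run f (y # xs) = Some 0)
          else None)"

definition partial_computable :: "(nat \<Rightarrow> nat option) \<Rightarrow> bool" where
  "partial_computable f \<longleftrightarrow> (\<exists>r. \<forall>x. f x = run r [x])"

definition partial_computable2 :: "(nat \<Rightarrow> nat \<Rightarrow> nat option) \<Rightarrow> bool" where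
  "partial_computable2 f \<longleftrightarrow> (\<exists>r. \<forall>x y. f x y = run r [x, y])"

definition computable :: "(nat \<Rightarrow> nat) \<Rightarrow> bool" where
  "computable f \<longleftrightarrow> partial_computable (\<lambda>x. Some (f x))"

text \<open>
  Acceptable numberings in the sense of Rogers: effective numberings of all partial computable
  functions into which every other effective numbering translates computably.
\<close>

definition acceptable :: "(nat \<Rightarrow> nat \<Rightarrow> nat option) \<Rightarrow> bool" where
  "acceptable \<phi> \<longleftrightarrow>
     range \<phi> = {f. partial_computable f} \<and>
     partial_computable2 \<phi> \<and>
     (\<forall>\<psi>. partial_computable2 \<psi> \<longrightarrow> (\<exists>s. computable s \<and> (\<forall>e. \<phi> (s e) = \<psi> e)))"

definition C_index :: "(nat \<Rightarrow> nat \<Rightarrow> nat option) \<Rightarrow> nat \<Rightarrow> bool" where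
  "C_index \<phi> e \<longleftrightarrow> (\<forall>x. \<phi> e x = Some 0 \<or> \<phi> e x = Some 1)"

definition C_set :: "(nat \<Rightarrow> nat \<Rightarrow> nat option) \<Rightarrow> nat \<Rightarrow> nat set" where
  "C_set \<phi> e = {x. \<phi> e x = Some 1}"

definition REC :: "nat set set" where
  "REC = {L. computable (\<lambda>x. if x \<in> L then 1 else 0)}"

text \<open>In texts and in finite sequences, \<^const>\<open>None\<close> is the pause symbol.\<close>

type_synonym symbol_text = "nat \<Rightarrow> nat option"

definition content :: "symbol_text \<Rightarrow> nat set" where
  "content T = {x. Some x \<in> range T}"

text \<open>
  A learner is a unary partial computable function; its inputs are coded as numbers.
  The empty input has code 0 both for sequences and for the initial iterative input
  (\<^term>\<open>list_encode [] = 0\<close>).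
\<close>

definition code_symbol :: "nat option \<Rightarrow> nat" where
  "code_symbol a = (case a of None \<Rightarrow> 0 | Some x \<Rightarrow> Suc x)"

definition code_seq :: "nat option list \<Rightarrow> nat" where
  "code_seq \<sigma> = list_encode (map code_symbol \<sigma>)"

definition code_step :: "nat \<Rightarrow> nat option \<Rightarrow> nat" where
  "code_step e a = Suc (prod_encode (e, code_symbol a))"

text \<open>
  Hypothesis sequences may be undefined at some positions. An iterative learner whose previous
  hypothesis is undefined has no further hypotheses.
\<close>

definition G :: "(nat \<Rightarrow> nat option) \<Rightarrow> symbol_text \<Rightarrow> nat \<Rightarrow> nat option" where
  "G h T i = h (code_seq (map T [0..<i]))"

primrec It :: "(nat \<Rightarrow> nat option) \<Rightarrow> symbol_text \<Rightarrow> nat \<Rightarrow> nat option" where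
  "It h T 0 = h (code_seq [])"
| "It h T (Suc i) = Option.bind (It h T i) (\<lambda>e. h (code_step e (T i)))"

definition Bc_C ::
  "(nat \<Rightarrow> nat \<Rightarrow> nat option) \<Rightarrow> (nat \<Rightarrow> nat option) \<Rightarrow> symbol_text \<Rightarrow> bool" where
  "Bc_C \<phi> p T \<longleftrightarrow>
     (\<exists>n0. \<forall>n\<ge>n0. \<exists>e. p n = Some e \<and> C_index \<phi> e \<and> C_set \<phi> e = content T)"

definition Txt_Bc_C_learns ::
  "(nat \<Rightarrow> nat \<Rightarrow> nat option) \<Rightarrow> ((nat \<Rightarrow> nat option) \<Rightarrow> symbol_text \<Rightarrow> nat \<Rightarrow> nat option)
    \<Rightarrow> (nat \<Rightarrow> nat option) \<Rightarrow> nat set \<Rightarrow> bool" where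
  "Txt_Bc_C_learns \<phi> \<beta> h L \<longleftrightarrow> (\<forall>T. content T = L \<longrightarrow> Bc_C \<phi> (\<beta> h T) T)"

definition Txt_Bc_C_REC ::
  "(nat \<Rightarrow> nat \<Rightarrow> nat option) \<Rightarrow> ((nat \<Rightarrow> nat option) \<Rightarrow> symbol_text \<Rightarrow> nat \<Rightarrow> nat option)
    \<Rightarrow> nat set set set" where
  "Txt_Bc_C_REC \<phi> \<beta> =
     {\<L>. \<L> \<subseteq> REC \<and>
        (\<exists>h. partial_computable h \<and> (\<forall>L\<in>\<L>. Txt_Bc_C_learns \<phi> \<beta> h L))}"

end

theory Submission
  imports Defs
begin

text \<open>
  An iterative learner is simulated on a finite sequence by folding it over the sequence. For the
  converse, an iterative learner can remember the whole input in its hypothesis: after reading the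
  sequence \<open>\<sigma>\<close> it conjectures an index \<open>t \<sigma>\<close> of the function
  \<open>x \<mapsto> \<phi> (h \<sigma>) x\<close>, where \<open>t\<close> is total even if the given learner \<open>h\<close> is not,
  and \<open>\<sigma>\<close> can be computed from \<open>t \<sigma>\<close>.

  Such an invertible \<open>t\<close> exists in every acceptable numbering. The recursion theorem yields a
  computable \<open>r\<close> such that, for \<open>3 ^ n \<le> m < 3 ^ Suc n\<close>, the number \<open>r m\<close> is an index of the
  \<open>n\<close>-th function to be translated, unless \<open>r m\<close> already occurs among the \<open>r k\<close> with
  \<open>k < 3 ^ n\<close>; in that case it is an index of the constant function \<open>m\<close>. If all \<open>m\<close> in this block
  were of the second kind, the \<open>2 * 3 ^ n\<close> numbers \<open>r m\<close> would be pairwise distinct members of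
  a set with at most \<open>3 ^ n\<close> elements.
\<close>

section \<open>Recursive functions\<close>

text \<open>
  Composition is strict, so a case distinction is programmed as a primitive recursion whose step
  ignores the counter and the previous value: the step need not be defined where the counter is 0.
\<close>

lemma rec_nat_bind_const:
  "rec_nat (Some a) (\<lambda>m r. Option.bind r (\<lambda>v. c)) n = (if n = 0 then Some a else c)"
  by (induction n) (auto split: bind_splits)

lemma run_Mu_total:
  assumes "\<And>y. run f (y # xs) = Some (g y)" and "\<exists>y. g y = 0"
  shows "run (Mu f) xs = Some (LEAST y. g y = 0)"
  using assms by simp

primrec r_const :: "nat \<Rightarrow> recf" where
  "r_const 0 = Zero"
| "r_const (Suc n) = Comp Succ [r_const n]"

lemma run_r_const [simp]: "run (r_const n) xs = Some n"
  by (induction n) simp_all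

definition r_add :: recf where
  "r_add = PrimRec (Proj 0) (Comp Succ [Proj 1])"

lemma run_r_add [simp]: "run r_add [x, y] = Some (x + y)"
  unfolding r_add_def by (induction x) simp_all

definition r_mult :: recf where
  "r_mult = PrimRec Zero (Comp r_add [Proj 1, Proj 2])"

lemma run_r_mult [simp]: "run r_mult [x, y] = Some (x * y)"
  unfolding r_mult_def by (induction x) simp_all

definition r_pred :: recf where
  "r_pred = Comp (PrimRec Zero (Proj 0)) [Proj 0]"

lemma run_r_pred [simp]: "run r_pred [x] = Some (x - 1)"
  unfolding r_pred_def by (induction x) simp_all

definition r_minus :: recf where
  "r_minus = Comp (PrimRec (Proj 0) (Comp r_pred [Proj 1])) [Proj 1, Proj 0]"

lemma run_r_minus [simp]: "run r_minus [x, y] = Some (x - y)"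
  unfolding r_minus_def by (induction y) simp_all

text \<open>Truncated subtraction makes this \<open>|x - y|\<close>: an equality test for searches
  and products.\<close>

definition r_dist :: recf where
  "r_dist = Comp r_add [r_minus, Comp r_minus [Proj 1, Proj 0]]"

lemma run_r_dist [simp]: "run r_dist [x, y] = Some ((x - y) + (y - x))"
  by (simp add: r_dist_def)

definition r_pow3 :: recf where
  "r_pow3 = PrimRec (r_const 1) (Comp r_mult [r_const 3, Proj 1])"

lemma run_r_pow3 [simp]: "run r_pow3 [n] = Some (3 ^ n)"
  unfolding r_pow3_def by (induction n) simp_all

definition log3 :: "nat \<Rightarrow> nat" where
  "log3 m = (LEAST n. m < 3 ^ Suc n)"

lemma log3_eqI: "3 ^ n \<le> m \<Longrightarrow> m < 3 ^ Suc n \<Longrightarrow> log3 m = n"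
  unfolding log3_def
proof (rule Least_equality)
  fix k assume n: "3 ^ n \<le> m" and k: "m < 3 ^ Suc k"
  have "(3::nat) ^ n < 3 ^ Suc k"
    using n k by (rule le_less_trans)
  then show "n \<le> k"
    using power_strict_increasing_iff[of "3::nat" n "Suc k"] by simp
qed

definition r_log3 :: recf where
  "r_log3 = Mu (Comp r_minus [Comp Succ [Proj 1], Comp r_pow3 [Comp Succ [Proj 0]]])"

lemma run_r_log3 [simp]: "run r_log3 [m] = Some (log3 m)"
proof -
  have "m < 3 ^ m"
    by (rule power_gt_expt) simp
  then have "\<exists>n. Suc m - 3 ^ Suc n = 0"
    by (intro exI[of _ m]) simp
  then show ?thesis
    unfolding r_log3_def log3_def
    by (subst run_Mu_total[where g = "\<lambda>n. Suc m - 3 ^ Suc n"]) (simp_all add: Suc_le_eq)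
qed

section \<open>Cantor pairing\<close>

definition r_triangle :: recf where
  "r_triangle = PrimRec Zero (Comp r_add [Proj 1, Comp Succ [Proj 0]])"

lemma run_r_triangle [simp]: "run r_triangle [n] = Some (triangle n)"
  unfolding r_triangle_def by (induction n) simp_all

definition r_pair :: recf where
  "r_pair = Comp r_add [Comp r_triangle [r_add], Proj 0]"

lemma run_r_pair [simp]: "run r_pair [x, y] = Some (prod_encode (x, y))"
  by (simp add: r_pair_def prod_encode_def)

lemma triangle_mono: "m \<le> n \<Longrightarrow> triangle m \<le> triangle n"
  by (induction rule: dec_induct) simp_all

text \<open>The codes of pairs with sum \<open>k\<close> start at \<open>triangle k\<close> and end
  just before \<open>triangle (Suc k)\<close>.\<close>

lemma Least_triangle: "(LEAST k. prod_encode (x, y) < triangle (Suc k)) = x + y"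
proof (rule Least_equality)
  show "prod_encode (x, y) < triangle (Suc (x + y))"
    by (simp add: prod_encode_def)
next
  fix k assume k: "prod_encode (x, y) < triangle (Suc k)"
  show "x + y \<le> k"
  proof (rule ccontr)
    assume "\<not> x + y \<le> k"
    then have "triangle (Suc k) \<le> triangle (x + y)"
      by (intro triangle_mono) simp
    with k show False
      by (simp add: prod_encode_def)
  qed
qed

definition r_diag :: recf where
  "r_diag = Mu (Comp r_minus [Comp Succ [Proj 1], Comp r_triangle [Comp Succ [Proj 0]]])"

lemma run_r_diag: "run r_diag [prod_encode (x, y)] = Some (x + y)"
proof -
  let ?g = "\<lambda>k. Suc (prod_encode (x, y)) - triangle (Suc k)"
  have "?g (x + y) = 0"
    by (simp add: prod_encode_def)
  then have "run r_diag [prod_encode (x, y)] = Some (LEAST k. ?g k = 0)"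
    unfolding r_diag_def by (intro run_Mu_total) auto
  then show ?thesis
    using Least_triangle[of x y] by (simp add: Suc_le_eq del: triangle_Suc)
qed

definition r_fst :: recf where
  "r_fst = Comp r_minus [Proj 0, Comp r_triangle [r_diag]]"

lemma run_r_fst [simp]: "run r_fst [prod_encode (x, y)] = Some x"
  unfolding r_fst_def by (simp add: run_r_diag) (simp add: prod_encode_def)

definition r_snd :: recf where
  "r_snd = Comp r_minus [r_diag, r_fst]"

lemma run_r_snd [simp]: "run r_snd [prod_encode (x, y)] = Some y"
  by (simp add: r_snd_def run_r_diag)

section \<open>Coded lists\<close>

definition r_hd :: recf where
  "r_hd = Comp r_fst [r_pred]"

lemma run_r_hd [simp]: "run r_hd [list_encode (x # xs)] = Some x"
  by (simp add: r_hd_def)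

definition r_tl :: recf where
  "r_tl = Comp r_snd [r_pred]"

lemma run_r_tl [simp]: "run r_tl [list_encode xs] = Some (list_encode (tl xs))"
proof (cases xs)
  case Nil
  \<comment> \<open>\<open>r_pred\<close> keeps the code \<open>0\<close> of the empty list at
    \<open>0\<close>, which is then decoded as a pair.\<close>
  have "prod_encode (0, 0) = 0"
    by (simp add: prod_encode_def)
  then have "run r_snd [0] = Some 0"
    using run_r_snd[of 0 0] by simp
  with Nil show ?thesis
    by (simp add: r_tl_def)
qed (simp add: r_tl_def)

definition r_drop :: recf where
  "r_drop = PrimRec (Proj 0) (Comp r_tl [Proj 1])"

lemma run_r_drop [simp]: "run r_drop [i, list_encode xs] = Some (list_encode (drop i xs))"
  unfolding r_drop_def by (induction i) (simp_all add: drop_Suc tl_drop)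

lemma list_encode_eq_0_iff [simp]: "list_encode xs = 0 \<longleftrightarrow> xs = []"
  using list_encode_eq[of xs "[]"] by simp

definition r_length :: recf where
  "r_length = Mu r_drop"

lemma run_r_length [simp]: "run r_length [list_encode xs] = Some (length xs)"
proof -
  have "run r_length [list_encode xs] = Some (LEAST i. list_encode (drop i xs) = 0)"
    unfolding r_length_def by (rule run_Mu_total) auto
  also have "(LEAST i. list_encode (drop i xs) = 0) = length xs"
    by (rule Least_equality) simp_all
  finally show ?thesis .
qed

definition r_foldl :: "recf \<Rightarrow> recf \<Rightarrow> recf" where
  "r_foldl b s =
     Comp (PrimRec b (Comp s [Proj 1, Comp r_hd [Comp r_drop [Proj 0, Proj 2]]]))
       [r_length, Proj 0]"

lemma run_r_foldl:
  "run (r_foldl b s) [list_encode xs] =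
     foldl (\<lambda>r a. Option.bind r (\<lambda>v. run s [v, a])) (run b [list_encode xs]) xs"
proof -
  let ?P = "PrimRec b (Comp s [Proj 1, Comp r_hd [Comp r_drop [Proj 0, Proj 2]]])"
  have "run ?P [i, list_encode xs] =
      foldl (\<lambda>r a. Option.bind r (\<lambda>v. run s [v, a])) (run b [list_encode xs]) (take i xs)"
    if "i \<le> length xs" for i
    using that
  proof (induction i)
    case (Suc i)
    then have "i < length xs"
      by simp
    then have "run r_hd [list_encode (drop i xs)] = Some (xs ! i)"
      by (simp add: Cons_nth_drop_Suc[symmetric] del: list_encode.simps)
    then have step: "run ?P [Suc i, list_encode xs] =
        Option.bind (run ?P [i, list_encode xs]) (\<lambda>v. run s [v, xs ! i])"
      by simp
    show ?case
      unfolding step using Suc by (simp add: take_Suc_conv_app_nth del: run.simps)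
  qed simp
  from this[of "length xs"] show ?thesis
    by (simp add: r_foldl_def del: run.simps(5))
qed

definition r_rev :: recf where
  "r_rev = r_foldl Zero (Comp Succ [Comp r_pair [Proj 1, Proj 0]])"

lemma run_r_rev [simp]: "run r_rev [list_encode xs] = Some (list_encode (rev xs))"
proof -
  have "foldl (\<lambda>r a. Option.bind r (\<lambda>v. Some (Suc (prod_encode (a, v))))) (Some (list_encode ys)) xs =
      Some (list_encode (rev xs @ ys))" for ys
    by (induction xs arbitrary: ys) (simp_all flip: list_encode.simps(2))
  from this[of "[]"] show ?thesis
    by (simp add: r_rev_def run_r_foldl)
qed

text \<open>A bounded quantifier as a product: it is nonzero iff \<open>r m\<close> differs from
  every \<open>r k\<close> with \<open>k < b\<close>. The parameter \<open>u\<close> leaves room for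
  the self-reference of the recursion theorem.\<close>

definition r_fresh :: "recf \<Rightarrow> recf" where
  "r_fresh q =
     PrimRec (r_const 1)
       (Comp r_mult [Proj 1, Comp r_dist [Comp q [Proj 3, Proj 0], Comp q [Proj 3, Proj 2]]])"

lemma run_r_fresh:
  assumes "\<And>k. run q [u, k] = Some (r k)"
  shows "run (r_fresh q) [b, m, u] = Some (\<Prod>k<b. (r k - r m) + (r m - r k))"
  unfolding r_fresh_def by (induction b) (simp_all add: assms)

lemma prod_dist_eq_0_iff:
  fixes r :: "nat \<Rightarrow> nat"
  shows "(\<Prod>k<b. (r k - r m) + (r m - r k)) = 0 \<longleftrightarrow> r m \<in> r ` {..<b}"
  by auto (metis image_eqI lessThan_iff)

section \<open>Invertible translations into acceptable numberings\<close>

lemma exists_fresh_in_block: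
  fixes r :: "nat \<Rightarrow> nat" and \<phi> :: "nat \<Rightarrow> nat \<Rightarrow> nat option"
  assumes const: "\<And>m x. r m \<in> r ` {..<3 ^ log3 m} \<Longrightarrow> \<phi> (r m) x = Some m"
  shows "\<exists>m. 3 ^ n \<le> m \<and> m < 3 ^ Suc n \<and> r m \<notin> r ` {..<3 ^ n}"
proof (rule ccontr)
  let ?B = "{3 ^ n..<3 ^ Suc n :: nat}"
  assume "\<not> ?thesis"
  then have sub: "r ` ?B \<subseteq> r ` {..<3 ^ n}"
    by auto
  have "\<phi> (r m) 0 = Some m" if "m \<in> ?B" for m
    using that sub log3_eqI[of n m] by (intro const) auto
  then have "inj_on r ?B"
    by (metis inj_onI option.inject)
  then have "card ?B = card (r ` ?B)"
    by (simp add: card_image)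
  also have "\<dots> \<le> card (r ` {..<3 ^ n})"
    using sub by (intro card_mono) auto
  also have "\<dots> \<le> 3 ^ n"
    using card_image_le[of "{..<3 ^ n}" r] by simp
  finally show False
    by simp
qed

lemma acceptable_invertible_translation:
  assumes acc: "acceptable \<phi>" and \<psi>: "partial_computable2 \<psi>"
  obtains t r_t r_inv where "\<And>n. \<phi> (t n) = \<psi> n"
    and "\<And>n. run r_t [n] = Some (t n)" and "\<And>n. run r_inv [t n] = Some n"
proof -
  obtain U where U: "\<And>e x. run U [e, x] = \<phi> e x"
    using acc unfolding acceptable_def partial_computable2_def by metis
  obtain P where P: "\<And>e x. run P [e, x] = \<psi> e x"
    using \<psi> unfolding partial_computable2_def by metis
  \<comment> \<open>Self-application: \<open>Q\<close> runs \<open>u\<close> on a pair containing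
    \<open>u\<close>. For an index \<open>v\<close> of \<open>d\<close> below, this yields
    \<open>r m\<close>.\<close>
  define Q where "Q = Comp U [Proj 0, r_pair]"
  \<comment> \<open>The first argument codes \<open>(u, m)\<close>. Counter \<open>0\<close> means
    that \<open>r m\<close> is a repetition, and the output is \<open>m\<close>; otherwise
    \<open>P\<close> is run on \<open>log3 m\<close> and the second argument.\<close>
  define R where "R = Comp (PrimRec (Proj 0) (Comp P [Comp r_log3 [Proj 2], Proj 3]))
    [Comp (r_fresh Q) [Comp r_pow3 [Comp r_log3 [Comp r_snd [Proj 0]]],
       Comp r_snd [Proj 0], Comp r_fst [Proj 0]],
     Comp r_snd [Proj 0], Proj 1]"
  have "partial_computable2 (\<lambda>z x. run R [z, x])"
    unfolding partial_computable2_def by blast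
  then obtain d where "computable d" and d: "\<And>z. \<phi> (d z) = (\<lambda>x. run R [z, x])"
    using acc unfolding acceptable_def by blast
  then have "(\<lambda>z. Some (d z)) \<in> range \<phi>"
    using acc unfolding acceptable_def computable_def by auto
  then obtain v where v: "\<And>z. \<phi> v z = Some (d z)"
    by (metis rangeE)
  define r where "r m = d (prod_encode (v, m))" for m
  have Q: "run Q [v, m] = Some (r m)" for m
    by (simp add: Q_def U v r_def)
  have \<phi>_r: "\<phi> (r m) x = (if r m \<in> r ` {..<3 ^ log3 m} then Some m else \<psi> (log3 m) x)" for m x
  proof -
    have "\<phi> (r m) x = run R [prod_encode (v, m), x]"
      by (simp add: r_def d)
    then show ?thesis
      by (simp add: R_def run_r_fresh[of Q v r, OF Q] rec_nat_bind_const P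
          prod_dist_eq_0_iff del: prod_zero_iff)
  qed
  define s where "s n = (LEAST m. 3 ^ n \<le> m \<and> r m \<notin> r ` {..<3 ^ n})" for n
  have ex: "\<exists>m. 3 ^ n \<le> m \<and> m < 3 ^ Suc n \<and> r m \<notin> r ` {..<3 ^ n}" for n
    by (rule exists_fresh_in_block[of _ \<phi>]) (simp add: \<phi>_r)
  have s: "3 ^ n \<le> s n \<and> r (s n) \<notin> r ` {..<3 ^ n}" for n
    unfolding s_def by (rule LeastI_ex) (use ex in blast)
  \<comment> \<open>The search for \<open>s n\<close> has no upper bound built in; the fresh element
    of the block provides it.\<close>
  have s_less: "s n < 3 ^ Suc n" for n
  proof -
    obtain m where "3 ^ n \<le> m \<and> r m \<notin> r ` {..<3 ^ n}" and m: "m < 3 ^ Suc n"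
      using ex[of n] by blast
    then have "s n \<le> m"
      unfolding s_def by (intro Least_le)
    also note m
    finally show ?thesis .
  qed
  \<comment> \<open>A sum of truncated differences is \<open>0\<close> iff both are:
    \<open>3 ^ n \<le> m\<close>, and the freshness product is at least \<open>1\<close>.\<close>
  define r_s where "r_s = Mu (Comp r_add
    [Comp r_minus [Comp r_pow3 [Proj 1], Proj 0],
     Comp r_minus [r_const 1, Comp (r_fresh Q) [Comp r_pow3 [Proj 1], Proj 0, r_const v]]])"
  have r_s: "run r_s [n] = Some (s n)" for n
  proof -
    let ?g = "\<lambda>m. (3 ^ n - m) + (1 - (\<Prod>k<3 ^ n. (r k - r m) + (r m - r k)))"
    have g: "?g m = 0 \<longleftrightarrow> 3 ^ n \<le> m \<and> r m \<notin> r ` {..<3 ^ n}" for m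
    proof -
      have "(b - m) + (1 - p) = 0 \<longleftrightarrow> b \<le> m \<and> p \<noteq> 0" for b p :: nat
        by auto
      then show ?thesis
        by (simp only: prod_dist_eq_0_iff)
    qed
    have "run r_s [n] = Some (LEAST m. ?g m = 0)"
      unfolding r_s_def
    proof (rule run_Mu_total)
      show "\<exists>m. ?g m = 0"
        unfolding g using ex by blast
    qed (simp add: run_r_fresh[of Q v r, OF Q])
    then show ?thesis
      unfolding g s_def .
  qed
  define r_inv where
    "r_inv = Comp r_log3 [Mu (Comp r_dist [Comp Q [r_const v, Proj 0], Proj 1])]"
  show thesis
  proof
    show "\<phi> (r (s n)) = \<psi> n" for n
      using s[of n] log3_eqI[of n "s n"] s_less[of n] by (auto simp: \<phi>_r)
    show "run (Comp Q [r_const v, r_s]) [n] = Some (r (s n))" for n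
      by (simp add: r_s Q)
    show "run r_inv [r (s n)] = Some n" for n
    proof -
      let ?g = "\<lambda>m. (r m - r (s n)) + (r (s n) - r m)"
      let ?m = "LEAST m. ?g m = 0"
      have "?g (s n) = 0"
        by simp
      then have "?m \<le> s n" and "?g ?m = 0"
        by (rule Least_le, rule LeastI)
      \<comment> \<open>\<open>?m\<close> is at most \<open>s n\<close>, and it is not below
        \<open>3 ^ n\<close> because \<open>r (s n)\<close> is fresh; so it lies in block
        \<open>n\<close>.\<close>
      then have "log3 ?m = n"
        using s[of n] s_less[of n] by (intro log3_eqI) (auto simp: not_less[symmetric])
      moreover have "run (Mu (Comp r_dist [Comp Q [r_const v, Proj 0], Proj 1])) [r (s n)] = Some ?m"
        by (rule run_Mu_total) (auto simp: Q)
      ultimately show ?thesis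
        by (simp add: r_inv_def del: run.simps(6))
    qed
  qed
qed

section \<open>Iterative and full-information learners\<close>

lemma partial_computable_G_of_It:
  assumes "partial_computable h"
  obtains h' where "partial_computable h'" and "\<And>T. G h' T = It h T"
proof -
  obtain H where H: "\<And>x. run H [x] = h x"
    using assms unfolding partial_computable_def by metis
  \<comment> \<open>\<open>Zero\<close> codes the empty input, \<open>Succ\<close> of a pair is
    \<open>code_step\<close>; undefined hypotheses propagate through the fold as in
    \<open>It\<close>.\<close>
  define h' where "h' x = run (r_foldl (Comp H [Zero]) (Comp H [Comp Succ [r_pair]])) [x]" for x
  have "G h' T i = It h T i" for T i
  proof (induction i)
    case 0
    show ?case
      using run_r_foldl[of "Comp H [Zero]" "Comp H [Comp Succ [r_pair]]" "[]"]
      by (simp add: G_def h'_def code_seq_def H)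
  next
    case (Suc i)
    then show ?case
      by (simp add: G_def h'_def code_seq_def run_r_foldl H code_step_def)
  qed
  moreover have "partial_computable h'"
    unfolding partial_computable_def h'_def by blast
  ultimately show thesis
    by (intro that) auto
qed

lemma partial_computable_It_of_G:
  assumes acc: "acceptable \<phi>" and "partial_computable h"
  obtains h' where "partial_computable h'"
    and "\<And>T i e. G h T i = Some e \<Longrightarrow> \<exists>e'. It h' T i = Some e' \<and> \<phi> e' = \<phi> e"
proof -
  obtain H where H: "\<And>x. run H [x] = h x"
    using assms unfolding partial_computable_def by metis
  obtain U where U: "\<And>e x. run U [e, x] = \<phi> e x"
    using acc unfolding acceptable_def partial_computable2_def by metis
  \<comment> \<open>New symbols are consed to the front of the stored list, so \<open>w\<close>
    codes the reversed input.\<close>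
  define \<psi> where "\<psi> w x = run (Comp U [Comp H [Comp r_rev [Proj 0]], Proj 1]) [w, x]" for w x
  have "partial_computable2 \<psi>"
    unfolding partial_computable2_def \<psi>_def by blast
  then obtain t r_t r_inv where t: "\<And>n. \<phi> (t n) = \<psi> n"
    and r_t: "\<And>n. run r_t [n] = Some (t n)" and r_inv: "\<And>n. run r_inv [t n] = Some n"
    using acceptable_invertible_translation[OF acc] by blast
  \<comment> \<open>Input \<open>0\<close> gives the empty list. Otherwise \<open>r_inv\<close>
    recovers the stored list from the previous hypothesis; it is not run on input
    \<open>0\<close>.\<close>
  define r_state where "r_state = Comp (PrimRec Zero (Comp Succ [Comp r_pair
    [Comp r_snd [Comp r_pred [Proj 2]], Comp r_inv [Comp r_fst [Comp r_pred [Proj 2]]]]]))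
    [Proj 0, Proj 0]"
  define h' where "h' x = run (Comp r_t [r_state]) [x]" for x
  have h'_0: "h' 0 = Some (t 0)"
    by (simp add: h'_def r_state_def r_t)
  have h'_step: "h' (code_step (t w) a) = Some (t (Suc (prod_encode (code_symbol a, w))))" for w a
    by (simp add: h'_def r_state_def r_t r_inv code_step_def rec_nat_bind_const del: nat.rec)
  \<comment> \<open>This is defined everywhere: where \<open>h\<close> is undefined, the conjecture
    is an index of the nowhere defined function.\<close>
  have It: "It h' T i = Some (t (list_encode (rev (map code_symbol (map T [0..<i])))))" for T i
    by (induction i) (simp_all add: h'_0 h'_step code_seq_def)
  have "\<exists>e'. It h' T i = Some e' \<and> \<phi> e' = \<phi> e" if "G h T i = Some e" for T i e
    using that by (auto simp: It t \<psi>_def G_def code_seq_def H U)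
  moreover have "partial_computable h'"
    unfolding partial_computable_def h'_def by blast
  ultimately show thesis
    by (intro that)
qed

text \<open>\<open>C_index\<close> and \<open>C_set\<close> depend on an index only through the
  function it names.\<close>

lemma Bc_C_mono:
  assumes "Bc_C \<phi> p T" and "\<And>i e. p i = Some e \<Longrightarrow> \<exists>e'. q i = Some e' \<and> \<phi> e' = \<phi> e"
  shows "Bc_C \<phi> q T"
proof -
  obtain n0 where n0: "\<And>n. n \<ge> n0 \<Longrightarrow> \<exists>e. p n = Some e \<and> C_index \<phi> e \<and> C_set \<phi> e = content T"
    using assms(1) unfolding Bc_C_def by blast
  have "\<exists>e. q n = Some e \<and> C_index \<phi> e \<and> C_set \<phi> e = content T" if n: "n \<ge> n0" for n
  proof -
    obtain e where e: "p n = Some e" "C_index \<phi> e" "C_set \<phi> e = content T"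
      using n0[OF n] by blast
    then obtain e' where "q n = Some e'" and "\<phi> e' = \<phi> e"
      using assms(2) by blast
    with e show ?thesis
      by (simp add: C_index_def C_set_def)
  qed
  then show ?thesis
    unfolding Bc_C_def by blast
qed

theorem theorem16:
  fixes \<phi> :: "nat \<Rightarrow> nat \<Rightarrow> nat option"
  assumes "acceptable \<phi>"
  shows "Txt_Bc_C_REC \<phi> It = Txt_Bc_C_REC \<phi> G"
proof (intro equalityI subsetI)
  fix \<L> assume "\<L> \<in> Txt_Bc_C_REC \<phi> It"
  then obtain h where "\<L> \<subseteq> REC" and h: "partial_computable h"
    and "\<forall>L\<in>\<L>. Txt_Bc_C_learns \<phi> It h L"
    unfolding Txt_Bc_C_REC_def by blast
  moreover obtain h' where "partial_computable h'" and "\<And>T. G h' T = It h T"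
    using partial_computable_G_of_It[OF h] by blast
  ultimately show "\<L> \<in> Txt_Bc_C_REC \<phi> G"
    unfolding Txt_Bc_C_REC_def Txt_Bc_C_learns_def by auto
next
  fix \<L> assume "\<L> \<in> Txt_Bc_C_REC \<phi> G"
  then obtain h where REC: "\<L> \<subseteq> REC" and h: "partial_computable h"
    and learns: "\<forall>L\<in>\<L>. Txt_Bc_C_learns \<phi> G h L"
    unfolding Txt_Bc_C_REC_def by blast
  obtain h' where h': "partial_computable h'"
    and It: "\<And>T i e. G h T i = Some e \<Longrightarrow> \<exists>e'. It h' T i = Some e' \<and> \<phi> e' = \<phi> e"
    using partial_computable_It_of_G[OF assms h] by blast
  have "Bc_C \<phi> (It h' T) T" if "Bc_C \<phi> (G h T) T" for T
    using that It by (rule Bc_C_mono)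
  with learns have "\<forall>L\<in>\<L>. Txt_Bc_C_learns \<phi> It h' L"
    unfolding Txt_Bc_C_learns_def by simp
  with REC h' show "\<L> \<in> Txt_Bc_C_REC \<phi> It"
    unfolding Txt_Bc_C_REC_def by blast
qed

end
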